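(* Assume that $8\zeta(\sigma)\le\sqrt n$, $0<\sigma\le s_4^2$ and $\kappa\ge 3/2$. Then with probability at least $1-2\epsilon$, $$\|G-\widetilde G\|_F\le\min_{r\in\{1,\dots,d\}}\sqrt{13\,r\,B(\lambda_1)^2+2\sum_{i=r+1}^d\lambda_i^2}.$$
   Context: Let $X\in\mathbb R^d$ be a random vector with $\mathbb E\|X\|^4<\infty$, $X_1,\dots,X_n$ an i.i.d. sample with the law of $X$, and $G=\mathbb E(XX^\top)$ its Gram matrix. $\mathbb S_d=\{\theta\in\mathbb R^d:\|\theta\|=1\}$ and $\|M\|_F=\mathrm{Tr}(M^\top M)^{1/2}$. Fix $a>0$, $\delta>0$, $\epsilon\in(0,1)$ and a threshold $\sigma\in(0,s_4^2]$, where $s_4^2=\mathbb E(\|X\|^4)^{1/2}$. Put $$\kappa=\sup_{\theta\in\mathbb R^d,\ \mathbb E(\langle\theta,X\rangle^2)>0}\frac{\mathbb E(\langle\theta,X\rangle^4)}{\mathbb E(\langle\theta,X\rangle^2)^2},\qquad c=\frac{15}{8\log(2)(\sqrt2-1)}\exp\Bigl(\frac{1+2\sqrt2}{2}\Bigr),$$ $$K=1+\Bigl\lceil a^{-1}\log\Bigl(\frac{n}{72(2+c)\kappa^{1/2}}\Bigr)\Bigr\rceil,$$ $$\zeta(t)=\sqrt{2(\kappa-1)\Bigl(\frac{(2+3c)s_4^2}{4(2+c)\kappa^{1/2}t}+\log(K/\epsilon)\Bigr)}\cosh(a/4)+\sqrt{\frac{2(2+c)\kappa^{1/2}s_4^2}{t}}\cosh(a/2),$$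 $$B_*(t)=\begin{cases}\dfrac{n^{-1/2}\zeta(\max\{t,\sigma\})}{1-4n^{-1/2}\zeta(\max\{t,\sigma\})} & \text{if }[6+(\kappa-1)^{-1}]\,\zeta(\max\{t,\sigma\})\le\sqrt n,\\ +\infty&\text{otherwise,}\end{cases}$$ $$B(t)=2\max\{t,\sigma\}B_*(\min\{t,s_4^2\})+7\delta\|G\|_F+\sigma.$$ Estimator. $Q$ is a random symmetric $d\times d$ matrix (a function of the sample), $Q=Q_+-Q_-$ is its decomposition into positive and negative parts, and $\widehat G=Q_+$. The estimator $Q$ has the following property (when $8\zeta(\sigma)\le\sqrt n$, $\sigma\le s_4^2$, $\kappa\ge3/2$): there is an event of probability at least $1-2\epsilon$ on which, for every $\theta\in\mathbb S_d$, $\bigl|\max\{\theta^\top Q\theta,\sigma\}-\max\{\theta^\top G\theta,\sigma\}\bigr|$ is at most each of $$2\max\{\theta^\top G\theta,\sigma\}B_*(\theta^\top G\theta)+5\delta\|G\|_F,\qquad 2\max\{\theta^\top Q\theta,\sigma\}B_*(\min\{\theta^\top Q\theta,s_4^2\})+5\delta\|G\|_F,$$ and $\bigl|\max\{\theta^\top\widehat G\theta,\sigma\}-\max\{\theta^\top G\theta,\sigma\}\bigr|$ is at most each of $$2\max\{\theta^\top G\theta,\sigma\}B_*(\theta^\top G\theta)+7\delta\|G\|_F,\qquad 2\max\{\theta^\top\widehat G\theta,\sigma\}B_*(\min\{\theta^\top\widehat G\theta,s_4^2\})+7\delta\|G\|_F.$$ $\lambda_1\ge\dots\ge\lambda_d$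 are the eigenvalues of $G$; $\widehat\lambda_1\ge\dots\ge\widehat\lambda_d$ are the eigenvalues of $\widehat G$ with corresponding orthonormal basis of eigenvectors $q_1,\dots,q_d$. The modified estimator is $$\widetilde G=\sum_{i=1}^d\widetilde\lambda_i q_iq_i^\top,\qquad \widetilde\lambda_i=\bigl[\widehat\lambda_i-B(\widehat\lambda_i)\bigr]_+,\quad [x]_+=\max\{x,0\}.$$ *)

theory Defs
  imports "HOL-Probability.Probability"
begin

section \<open>Real matrices\<close>

definition outer :: "real^'d \<Rightarrow> real^'d^'d" where
  "outer v = (\<chi> i j. v $ i * v $ j)"

definition quad_form :: "real^'d^'d \<Rightarrow> real^'d \<Rightarrow> real" where
  "quad_form A \<theta> = \<theta> \<bullet> (A *v \<theta>)"

definition frobenius :: "real^'d^'d \<Rightarrow> real" where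
  "frobenius A = sqrt (trace (transpose A ** A))"

text \<open>Eigenvalues and eigenvectors are indexed by the natural numbers from 1 to the
  dimension; values at other indices are irrelevant throughout.\<close>

definition sorted_eigenvalues :: "real^'d^'d \<Rightarrow> (nat \<Rightarrow> real) \<Rightarrow> bool" where
  "sorted_eigenvalues A lam \<longleftrightarrow>
     antimono_on {1..CARD('d)} lam \<and>
     (\<forall>\<mu>. card {i \<in> {1..CARD('d)}. lam i = \<mu>} = dim {v. A *v v = \<mu> *\<^sub>R v})"

definition orthonormal_eigenbasis ::
  "real^'d^'d \<Rightarrow> (nat \<Rightarrow> real) \<Rightarrow> (nat \<Rightarrow> real^'d) \<Rightarrow> bool" where
  "orthonormal_eigenbasis A \<mu> v \<longleftrightarrow>
     (\<forall>i\<in>{1..CARD('d)}. \<forall>j\<in>{1..CARD('d)}. v i \<bullet> v j = (if i = j then 1 else 0)) \<and>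
     (\<forall>i\<in>{1..CARD('d)}. A *v v i = \<mu> i *\<^sub>R v i)"

definition spectral_sum :: "(nat \<Rightarrow> real) \<Rightarrow> (nat \<Rightarrow> real^'d) \<Rightarrow> real^'d^'d" where
  "spectral_sum \<mu> v = (\<Sum>i = 1..CARD('d). \<mu> i *\<^sub>R outer (v i))"

text \<open>The positive and negative parts of a symmetric matrix do not depend on the
  orthonormal eigenbasis used to compute them.\<close>

definition pos_neg_parts :: "real^'d^'d \<Rightarrow> real^'d^'d \<Rightarrow> real^'d^'d \<Rightarrow> bool" where
  "pos_neg_parts A P N \<longleftrightarrow>
     (\<exists>\<mu> v. orthonormal_eigenbasis A \<mu> v \<and>
        P = spectral_sum (\<lambda>i. max (\<mu> i) 0) v \<and>
        N = spectral_sum (\<lambda>i. max (- \<mu> i) 0) v)"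


section \<open>Moments of a random vector\<close>

definition gram :: "'a measure \<Rightarrow> ('a \<Rightarrow> real^'d) \<Rightarrow> real^'d^'d" where
  "gram M X = (\<integral>\<omega>. outer (X \<omega>) \<partial>M)"

text \<open>\<open>s4_sq\<close> is the quantity $s_4^2$, not $s_4$.\<close>

definition s4_sq :: "'a measure \<Rightarrow> ('a \<Rightarrow> real^'d) \<Rightarrow> real" where
  "s4_sq M X = sqrt (\<integral>\<omega>. norm (X \<omega>) ^ 4 \<partial>M)"

text \<open>When the fourth moment is finite, the set of ratios below is bounded: a ratio depends
  only on the direction of the component of \<open>\<theta>\<close> orthogonal to the kernel of the Gram matrix,
  and it is continuous on the (compact) unit sphere of the range of that matrix.  The set is
  nonempty unless \<open>X = 0\<close> almost surely, that is, unless \<open>s4_sq M X = 0\<close>.  Outside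
  these conditions the real supremum has no meaning.\<close>

definition kurtosis :: "'a measure \<Rightarrow> ('a \<Rightarrow> real^'d) \<Rightarrow> real" where
  "kurtosis M X =
     (SUP \<theta> \<in> {\<theta>. (\<integral>\<omega>. (\<theta> \<bullet> X \<omega>)\<^sup>2 \<partial>M) > 0}.
        (\<integral>\<omega>. (\<theta> \<bullet> X \<omega>) ^ 4 \<partial>M) / (\<integral>\<omega>. (\<theta> \<bullet> X \<omega>)\<^sup>2 \<partial>M)\<^sup>2)"


section \<open>The bounds\<close>

definition const_c :: real where
  "const_c = 15 / (8 * ln 2 * (sqrt 2 - 1)) * exp ((1 + 2 * sqrt 2) / 2)"

definition const_K :: "'a measure \<Rightarrow> ('a \<Rightarrow> real^'d) \<Rightarrow> real \<Rightarrow> nat \<Rightarrow> int" where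
  "const_K M X a n =
     1 + \<lceil>inverse a * ln (real n / (72 * (2 + const_c) * sqrt (kurtosis M X)))\<rceil>"

definition zeta ::
  "'a measure \<Rightarrow> ('a \<Rightarrow> real^'d) \<Rightarrow> real \<Rightarrow> real \<Rightarrow> nat \<Rightarrow> real \<Rightarrow> real" where
  "zeta M X a \<epsilon> n t =
     sqrt (2 * (kurtosis M X - 1) *
           ((2 + 3 * const_c) * s4_sq M X / (4 * (2 + const_c) * sqrt (kurtosis M X) * t)
            + ln (real_of_int (const_K M X a n) / \<epsilon>))) * cosh (a / 4)
     + sqrt (2 * (2 + const_c) * sqrt (kurtosis M X) * s4_sq M X / t) * cosh (a / 2)"

definition B_star ::
  "'a measure \<Rightarrow> ('a \<Rightarrow> real^'d) \<Rightarrow> real \<Rightarrow> real \<Rightarrow> nat \<Rightarrow> real \<Rightarrow> real \<Rightarrow> ereal" where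
  "B_star M X a \<epsilon> n \<sigma> t =
     (if (6 + inverse (kurtosis M X - 1)) * zeta M X a \<epsilon> n (max t \<sigma>) \<le> sqrt (real n)
      then ereal ((zeta M X a \<epsilon> n (max t \<sigma>) / sqrt (real n))
                  / (1 - 4 * (zeta M X a \<epsilon> n (max t \<sigma>) / sqrt (real n))))
      else \<infinity>)"

definition B_bound ::
  "'a measure \<Rightarrow> ('a \<Rightarrow> real^'d) \<Rightarrow> real \<Rightarrow> real \<Rightarrow> nat \<Rightarrow> real \<Rightarrow> real \<Rightarrow> real \<Rightarrow> ereal" where
  "B_bound M X a \<epsilon> n \<sigma> \<delta> t =
     ereal (2 * max t \<sigma>) * B_star M X a \<epsilon> n \<sigma> (min t (s4_sq M X))
     + ereal (7 * \<delta> * frobenius (gram M X)) + ereal \<sigma>"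

text \<open>Square root on \<open>[0, \<infinity>]\<close>.\<close>

definition ereal_sqrt :: "ereal \<Rightarrow> ereal" where
  "ereal_sqrt x = (if x = \<infinity> then \<infinity> else ereal (sqrt (real_of_ereal x)))"

text \<open>An infinite bound \<open>b (lam i)\<close> gives the value 0 to the modified eigenvalue.\<close>

definition modified_estimator ::
  "(real \<Rightarrow> ereal) \<Rightarrow> (nat \<Rightarrow> real) \<Rightarrow> (nat \<Rightarrow> real^'d) \<Rightarrow> real^'d^'d" where
  "modified_estimator b lam q =
     spectral_sum (\<lambda>i. real_of_ereal (max (ereal (lam i) - b (lam i)) 0)) q"

end

theory Submission
  imports Defs
begin

text \<open>Write \<open>G\<close> for the Gram matrix, \<open>H\<close> for \<open>Ghat\<close>, with eigenvalues \<open>lam i\<close> and \<open>\<mu> i\<close>. On the event of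
  the deviation inequality, the quadratic forms of \<open>G\<close> and \<open>H\<close> at a unit vector differ by at most
  \<open>b\<close> of either of them, where \<open>b\<close> is the bound \<open>B\<close>, which is finite, nondecreasing and
  \<open>1/2\<close>-Lipschitz. Hence \<open>\<nu> i = max (\<mu> i - b (\<mu> i)) 0 \<le> lam i\<close> by the minimax principle, and
  \<open>G - T\<close> has operator norm at most \<open>5/2 b (lam 1)\<close> for the modified estimator \<open>T\<close>. In
  the pair of eigenbases \<open>p\<close> of \<open>G\<close> and \<open>q\<close> of \<open>T\<close>, the entries of \<open>G - T\<close> are
  \<open>(lam i - \<nu> j) * (q j \<bullet> p i)\<close>. The first \<open>r\<close> rows and columns contribute at most
  \<open>2 r (5/2 b (lam 1))\<^sup>2\<close> to the squared Frobenius norm. On the remaining block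
  \<open>(lam i - \<nu> j)\<^sup>2 \<le> (lam i)\<^sup>2 + (\<nu> j)\<^sup>2\<close>, which contributes at most \<open>2 (\<Sum>i>r. (lam i)\<^sup>2)\<close>.\<close>

section \<open>Orthonormal eigenbases\<close>

declare One_nat_def [simp del]

text \<open>The orthonormality clause of \<open>orthonormal_eigenbasis\<close> on its own, so that
  expansions and Parseval's identity can be used without naming a matrix.\<close>

definition orthonormal_basis :: "(nat \<Rightarrow> real^'d) \<Rightarrow> bool" where
  "orthonormal_basis v \<longleftrightarrow>
     (\<forall>i\<in>{1..CARD('d)}. \<forall>j\<in>{1..CARD('d)}. v i \<bullet> v j = (if i = j then 1 else 0))"

lemma orthonormal_basis_inner:
  fixes v :: "nat \<Rightarrow> real^'d"
  assumes "orthonormal_basis v" "i \<in> {1..CARD('d)}" "j \<in> {1..CARD('d)}"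
  shows "v i \<bullet> v j = (if i = j then 1 else 0)"
  using assms by (auto simp: orthonormal_basis_def)

lemma orthonormal_basis_norm:
  fixes v :: "nat \<Rightarrow> real^'d"
  assumes "orthonormal_basis v" "i \<in> {1..CARD('d)}"
  shows "norm (v i) = 1"
  using orthonormal_basis_inner[OF assms(1) assms(2) assms(2)] by (simp add: norm_eq_1)

lemma orthonormal_basis_independent:
  fixes v :: "nat \<Rightarrow> real^'d"
  assumes v: "orthonormal_basis v"
  shows "inj_on v {1..CARD('d)}" "independent (v ` {1..CARD('d)})"
proof -
  note vi = orthonormal_basis_inner[OF v]
  show inj: "inj_on v {1..CARD('d)}"
  proof (rule inj_onI)
    fix i j assume "i \<in> {1..CARD('d)}" "j \<in> {1..CARD('d)}" "v i = v j"
    then show "i = j" using vi[of i j] vi[of j j] by (auto split: if_splits)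
  qed
  show "independent (v ` {1..CARD('d)})"
  proof (rule pairwise_orthogonal_independent)
    show "pairwise orthogonal (v ` {1..CARD('d)})"
      using vi by (auto simp: pairwise_def orthogonal_def)
    show "0 \<notin> v ` {1..CARD('d)}"
      using vi by (metis (no_types, lifting) imageE inner_zero_left zero_neq_one)
  qed
qed

lemma orthonormal_basis_span:
  fixes v :: "nat \<Rightarrow> real^'d"
  assumes v: "orthonormal_basis v"
  shows "span (v ` {1..CARD('d)}) = UNIV"
proof -
  note ind = orthonormal_basis_independent[OF v]
  have "card (v ` {1..CARD('d)}) = CARD('d)"
    using ind(1) by (simp add: card_image)
  then show ?thesis
    using ind(2) card_ge_dim_independent[of "v ` {1..CARD('d)}" UNIV] by auto
qed

text \<open>The remainder \<open>y\<close> is orthogonal to every \<open>v j\<close>, hence to their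
  span, which is the whole space, hence to itself.\<close>

lemma orthonormal_basis_expand:
  fixes v :: "nat \<Rightarrow> real^'d"
  assumes v: "orthonormal_basis v"
  shows "(\<Sum>i = 1..CARD('d). (v i \<bullet> x) *\<^sub>R v i) = x"
proof -
  note vi = orthonormal_basis_inner[OF v]
  define y where "y = x - (\<Sum>i = 1..CARD('d). (v i \<bullet> x) *\<^sub>R v i)"
  have "orthogonal y w" if "w \<in> v ` {1..CARD('d)}" for w
  proof -
    obtain j where j: "j \<in> {1..CARD('d)}" "w = v j" using \<open>w \<in> _\<close> by auto
    have "(\<Sum>i = 1..CARD('d). (v i \<bullet> x) *\<^sub>R v i) \<bullet> v j
        = (\<Sum>i = 1..CARD('d). if i = j then v i \<bullet> x else 0)"
      unfolding inner_sum_left using vi j by (intro sum.cong) auto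
    also have "\<dots> = v j \<bullet> x" using j by simp
    finally show ?thesis unfolding y_def orthogonal_def j(2)
      by (simp only: inner_diff_left inner_commute[of x] diff_self)
  qed
  then have "orthogonal y y"
    by (intro orthogonal_to_span[of y "v ` {1..CARD('d)}" y])
      (simp_all add: orthonormal_basis_span[OF v])
  then show ?thesis by (simp add: y_def orthogonal_def)
qed

lemma orthonormal_basis_inner_sum:
  fixes v :: "nat \<Rightarrow> real^'d"
  assumes v: "orthonormal_basis v"
  shows "x \<bullet> y = (\<Sum>i = 1..CARD('d). (v i \<bullet> x) * (v i \<bullet> y))"
proof -
  have "x \<bullet> y = (\<Sum>i = 1..CARD('d). (v i \<bullet> x) *\<^sub>R v i) \<bullet> y"
    by (simp add: orthonormal_basis_expand[OF v])
  then show ?thesis by (simp add: inner_sum_left)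
qed

lemma orthonormal_basis_norm_sq:
  fixes v :: "nat \<Rightarrow> real^'d"
  assumes v: "orthonormal_basis v"
  shows "(norm x)\<^sup>2 = (\<Sum>i = 1..CARD('d). (v i \<bullet> x)\<^sup>2)"
  unfolding power2_norm_eq_inner orthonormal_basis_inner_sum[OF v, of x x]
  by (simp only: power2_eq_square)

lemma orthonormal_eigenbasis_basis:
  "orthonormal_eigenbasis A \<mu> v \<Longrightarrow> orthonormal_basis v"
  by (simp add: orthonormal_eigenbasis_def orthonormal_basis_def)

lemma orthonormal_eigenbasis_eigen:
  fixes A :: "real^'d^'d"
  shows "orthonormal_eigenbasis A \<mu> v \<Longrightarrow> i \<in> {1..CARD('d)} \<Longrightarrow> A *v v i = \<mu> i *\<^sub>R v i"
  by (simp add: orthonormal_eigenbasis_def)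

lemma eigenbasis_mult_vector:
  fixes A :: "real^'d^'d"
  assumes "orthonormal_eigenbasis A \<mu> v"
  shows "A *v x = (\<Sum>i = 1..CARD('d). (\<mu> i * (v i \<bullet> x)) *\<^sub>R v i)"
proof -
  have "A *v x = A *v (\<Sum>i = 1..CARD('d). (v i \<bullet> x) *\<^sub>R v i)"
    by (simp add: orthonormal_basis_expand[OF orthonormal_eigenbasis_basis[OF assms]])
  also have "\<dots> = (\<Sum>i = 1..CARD('d). (v i \<bullet> x) *\<^sub>R (A *v v i))"
    by (simp add: linear_sum linear_cmul)
  also have "\<dots> = (\<Sum>i = 1..CARD('d). (\<mu> i * (v i \<bullet> x)) *\<^sub>R v i)"
    using assms by (intro sum.cong) (simp_all add: orthonormal_eigenbasis_eigen mult.commute)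
  finally show ?thesis .
qed

lemma eigenbasis_inner:
  fixes A :: "real^'d^'d"
  assumes "orthonormal_eigenbasis A \<mu> v"
  shows "y \<bullet> (A *v x) = (\<Sum>i = 1..CARD('d). \<mu> i * (v i \<bullet> x) * (v i \<bullet> y))"
  unfolding eigenbasis_mult_vector[OF assms]
  by (simp add: inner_sum_right inner_commute)

lemma eigenbasis_self_adjoint:
  fixes A :: "real^'d^'d"
  assumes "orthonormal_eigenbasis A \<mu> v"
  shows "x \<bullet> (A *v y) = (A *v x) \<bullet> y"
  unfolding inner_commute[of "A *v x"] eigenbasis_inner[OF assms] by (simp add: ac_simps)

lemma eigenbasis_quad_form:
  fixes A :: "real^'d^'d"
  assumes "orthonormal_eigenbasis A \<mu> v"
  shows "quad_form A x = (\<Sum>i = 1..CARD('d). \<mu> i * (v i \<bullet> x)\<^sup>2)"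
  unfolding quad_form_def eigenbasis_inner[OF assms] by (simp add: power2_eq_square ac_simps)

lemma eigenbasis_quad_form_eigenvector:
  fixes A :: "real^'d^'d"
  assumes A: "orthonormal_eigenbasis A \<mu> v" and i: "i \<in> {1..CARD('d)}"
  shows "quad_form A (v i) = \<mu> i"
  using orthonormal_basis_inner[OF orthonormal_eigenbasis_basis[OF A] i i]
  by (simp add: quad_form_def orthonormal_eigenbasis_eigen[OF A i])

section \<open>Spectral sums, the Frobenius norm and the operator norm\<close>

lemma outer_mult_vector: "outer v *v x = (v \<bullet> x) *\<^sub>R v"
  by (simp add: vec_eq_iff outer_def matrix_vector_mult_def inner_vec_def
      sum_distrib_left ac_simps)

lemma sum_matrix_vector_mult:
  "(\<Sum>i\<in>I. f i) *v x = (\<Sum>i\<in>I. f i *v (x :: real^'d))"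
  by (induction I rule: infinite_finite_induct) (auto simp: matrix_vector_mult_add_rdistrib)

lemma spectral_sum_eigenbasis:
  fixes v :: "nat \<Rightarrow> real^'d"
  assumes v: "orthonormal_basis v"
  shows "orthonormal_eigenbasis (spectral_sum \<mu> v) \<mu> v"
proof -
  note vi = orthonormal_basis_inner[OF v]
  have "spectral_sum \<mu> v *v v j = \<mu> j *\<^sub>R v j" if j: "j \<in> {1..CARD('d)}" for j
  proof -
    have "spectral_sum \<mu> v *v v j = (\<Sum>i = 1..CARD('d). (\<mu> i * (v i \<bullet> v j)) *\<^sub>R v i)"
      by (simp add: spectral_sum_def sum_matrix_vector_mult scaleR_matrix_vector_assoc[symmetric]
          outer_mult_vector)
    also have "\<dots> = (\<Sum>i = 1..CARD('d). if i = j then \<mu> i *\<^sub>R v i else 0)"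
      using vi j by (intro sum.cong) auto
    finally show ?thesis using j by simp
  qed
  then show ?thesis using vi by (auto simp: orthonormal_eigenbasis_def)
qed

text \<open>Both bases diagonalise: \<open>A\<close> acts on \<open>p i\<close> and, by symmetry,
  \<open>B\<close> on \<open>q j\<close>, so \<open>A - B\<close> has the entries
  \<open>(lam i - \<mu> j) * (q j \<bullet> p i)\<close>. The total, row and column sums of their
  squares are all wanted for the block estimate in \<open>frobenius_diff_le\<close>.\<close>

lemma frobenius_eigenbases:
  fixes A B :: "real^'d^'d"
  assumes A: "orthonormal_eigenbasis A lam p" and B: "orthonormal_eigenbasis B \<mu> q"
  shows "(frobenius (A - B))\<^sup>2
    = (\<Sum>i = 1..CARD('d). \<Sum>j = 1..CARD('d). (lam i - \<mu> j)\<^sup>2 * (q j \<bullet> p i)\<^sup>2)"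
    and "i \<in> {1..CARD('d)} \<Longrightarrow> (norm ((A - B) *v p i))\<^sup>2
      = (\<Sum>j = 1..CARD('d). (lam i - \<mu> j)\<^sup>2 * (q j \<bullet> p i)\<^sup>2)"
    and "j \<in> {1..CARD('d)} \<Longrightarrow> (norm ((A - B) *v q j))\<^sup>2
      = (\<Sum>i = 1..CARD('d). (lam i - \<mu> j)\<^sup>2 * (q j \<bullet> p i)\<^sup>2)"
proof -
  let ?C = "A - B"
  note p = orthonormal_eigenbasis_basis[OF A] and q = orthonormal_eigenbasis_basis[OF B]
  note symA = eigenbasis_self_adjoint[OF A]
  note symB = eigenbasis_self_adjoint[OF B]
  have sym: "x \<bullet> (?C *v y) = (?C *v x) \<bullet> y" for x y
    by (simp add: matrix_vector_mult_diff_rdistrib inner_diff_left inner_diff_right symA symB)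
  have entry: "q j \<bullet> (?C *v p i) = (lam i - \<mu> j) * (q j \<bullet> p i)"
    if "i \<in> {1..CARD('d)}" "j \<in> {1..CARD('d)}" for i j
    by (simp add: matrix_vector_mult_diff_rdistrib inner_diff_right symB algebra_simps
        orthonormal_eigenbasis_eigen[OF A that(1)] orthonormal_eigenbasis_eigen[OF B that(2)])
  show col: "(norm (?C *v p i))\<^sup>2 = (\<Sum>j = 1..CARD('d). (lam i - \<mu> j)\<^sup>2 * (q j \<bullet> p i)\<^sup>2)"
    if "i \<in> {1..CARD('d)}" for i
    unfolding orthonormal_basis_norm_sq[OF q] using entry[OF that]
    by (intro sum.cong) (simp_all add: power_mult_distrib)
  show "(norm (?C *v q j))\<^sup>2 = (\<Sum>i = 1..CARD('d). (lam i - \<mu> j)\<^sup>2 * (q j \<bullet> p i)\<^sup>2)"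
    if "j \<in> {1..CARD('d)}" for j
  proof -
    have "p i \<bullet> (?C *v q j) = (lam i - \<mu> j) * (q j \<bullet> p i)" if "i \<in> {1..CARD('d)}" for i
      using entry[OF that \<open>j \<in> _\<close>] sym[of "p i" "q j"] by (simp only: inner_commute)
    then show ?thesis
      unfolding orthonormal_basis_norm_sq[OF p]
      by (intro sum.cong) (simp_all add: power_mult_distrib)
  qed
  have "(frobenius ?C)\<^sup>2 = (\<Sum>k\<in>UNIV. (norm (?C *v axis k 1))\<^sup>2)"
  proof -
    have "trace (transpose ?C ** ?C) = (\<Sum>k\<in>UNIV. (norm (?C *v axis k 1))\<^sup>2)"
      unfolding trace_def matrix_matrix_mult_def power2_norm_eq_inner inner_vec_def
        matrix_vector_mult_basis column_def transpose_def
      by simp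
    then show ?thesis by (simp add: frobenius_def sum_nonneg)
  qed
  \<comment> \<open>Column \<open>k\<close> is expanded in the basis \<open>p\<close>; symmetry
    moves \<open>?C\<close> onto \<open>p i\<close> and leaves coordinate \<open>k\<close> of
    \<open>?C *v p i\<close>.\<close>
  also have "\<dots> = (\<Sum>k\<in>UNIV. \<Sum>i = 1..CARD('d). ((?C *v p i) $ k)\<^sup>2)"
    unfolding orthonormal_basis_norm_sq[OF p] sym inner_axis by simp
  also have "\<dots> = (\<Sum>i = 1..CARD('d). (norm (?C *v p i))\<^sup>2)"
    unfolding power2_norm_eq_inner inner_vec_def inner_real_def power2_eq_square[of "_ $ _"]
    by (rule sum.swap)
  also have "\<dots> = (\<Sum>i = 1..CARD('d). \<Sum>j = 1..CARD('d). (lam i - \<mu> j)\<^sup>2 * (q j \<bullet> p i)\<^sup>2)"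
    using col by (intro sum.cong) auto
  finally show "(frobenius ?C)\<^sup>2
    = (\<Sum>i = 1..CARD('d). \<Sum>j = 1..CARD('d). (lam i - \<mu> j)\<^sup>2 * (q j \<bullet> p i)\<^sup>2)" .
qed

lemma frobenius_nonneg: "0 \<le> frobenius (A :: real^'d^'d)"
proof -
  have "trace (transpose A ** A) = (\<Sum>k\<in>UNIV. \<Sum>l\<in>UNIV. (A $ l $ k)\<^sup>2)"
    by (simp add: trace_def matrix_matrix_mult_def transpose_def power2_eq_square)
  then show ?thesis by (simp add: frobenius_def sum_nonneg)
qed

text \<open>Polarisation and the parallelogram law bound \<open>w \<bullet> (A *v u)\<close> by
  \<open>c\<close> times the mean of the squared norms of \<open>u\<close> and \<open>w\<close>.
  Taking \<open>u\<close> along \<open>x\<close> and \<open>w\<close> along \<open>A *v x\<close>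
  turns this into a bound on the operator norm.\<close>

lemma norm_mult_le_of_quad_form_le:
  fixes A :: "real^'d^'d"
  assumes sym: "\<And>x y. x \<bullet> (A *v y) = (A *v x) \<bullet> y"
    and bound: "\<And>x. norm x = 1 \<Longrightarrow> \<bar>quad_form A x\<bar> \<le> c"
  shows "norm (A *v x) \<le> c * norm x"
proof -
  have quad: "\<bar>z \<bullet> (A *v z)\<bar> \<le> c * (norm z)\<^sup>2" for z
  proof (cases "z = 0")
    case False
    let ?u = "z /\<^sub>R norm z"
    have "norm ?u = 1" using False by simp
    from bound[OF this] have "\<bar>z \<bullet> (A *v z) / (norm z)\<^sup>2\<bar> \<le> c"
      by (simp add: quad_form_def linear_cmul power2_eq_square divide_simps)
    then show ?thesis using False by (simp add: abs_divide divide_simps)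
  qed simp
  let ?y = "A *v x"
  show ?thesis
  proof (cases "x = 0 \<or> ?y = 0")
    case True
    \<comment> \<open>A unit vector exists, so \<open>c\<close> dominates some absolute
      value.\<close>
    have "0 \<le> c"
      using bound[of "axis undefined 1"] abs_ge_zero order_trans norm_axis_1 by blast
    then show ?thesis using True by auto
  next
    case False
    define s t where "s = norm x" and "t = norm ?y"
    have st: "s > 0" "t > 0" using False by (auto simp: s_def t_def)
    \<comment> \<open>The scalings give \<open>u\<close> and \<open>w\<close> the common norm
      \<open>s * t\<close>, so that passing to the mean of the squared norms loses nothing.\<close>
    define u w where "u = t *\<^sub>R x" and "w = s *\<^sub>R ?y"
    have nu: "(norm u)\<^sup>2 = s\<^sup>2 * t\<^sup>2" "(norm w)\<^sup>2 = s\<^sup>2 * t\<^sup>2"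
      by (simp_all add: u_def w_def s_def t_def power_mult_distrib)
    have uw: "w \<bullet> (A *v u) = s * t * t\<^sup>2"
      by (simp add: u_def w_def t_def linear_cmul power2_norm_eq_inner)
    have "4 * (w \<bullet> (A *v u)) = (u + w) \<bullet> (A *v (u + w)) - (u - w) \<bullet> (A *v (u - w))"
      using sym[of u w]
      by (simp add: linear_add linear_diff inner_diff_left inner_diff_right inner_add_left
          inner_add_right inner_commute matrix_vector_right_distrib matrix_vector_mult_diff_distrib)
    also have "\<dots> \<le> c * ((norm (u + w))\<^sup>2 + (norm (u - w))\<^sup>2)"
      using quad[of "u + w"] quad[of "u - w"] by (simp add: distrib_left abs_le_iff)
    also have "(norm (u + w))\<^sup>2 + (norm (u - w))\<^sup>2 = 2 * ((norm u)\<^sup>2 + (norm w)\<^sup>2)"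
      unfolding power2_norm_eq_inner by (simp add: inner_diff_left
          inner_diff_right inner_add_left inner_add_right inner_commute)
    also have "c * (2 * ((norm u)\<^sup>2 + (norm w)\<^sup>2)) = 4 * (c * s\<^sup>2 * t\<^sup>2)"
      unfolding nu by simp
    finally have "s * t\<^sup>2 * t \<le> s * t\<^sup>2 * (c * s)"
      unfolding uw by (simp add: power2_eq_square ac_simps)
    then show ?thesis using st by (simp add: s_def t_def)
  qed
qed

section \<open>Eigenbases from eigenvalues, and the minimax principle\<close>

text \<open>The dimension of each eigenspace of \<open>A\<close> being prescribed, orthonormal bases of the eigenspaces
  can be glued along the level sets of \<open>\<mu>\<close>.\<close>

lemma sorted_eigenvalues_eigenbasis:
  fixes A :: "real^'d^'d"
  assumes sym: "\<And>x y. x \<bullet> (A *v y) = (A *v x) \<bullet> y"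
    and A: "sorted_eigenvalues A \<mu>"
  obtains p where "orthonormal_eigenbasis A \<mu> p"
proof -
  let ?I = "\<lambda>m. {i \<in> {1..CARD('d)}. \<mu> i = m}" and ?E = "\<lambda>m. {x. A *v x = m *\<^sub>R x}"
  define good where "good m f \<longleftrightarrow> inj_on f (?I m) \<and> f ` ?I m \<subseteq> ?E m \<and>
      pairwise orthogonal (f ` ?I m) \<and> (\<forall>x\<in>f ` ?I m. norm x = 1)" for m and f :: "nat \<Rightarrow> real^'d"
  have ex: "\<exists>f. good m f" for m
  proof -
    have "subspace (?E m)"
      by (auto simp: subspace_def matrix_vector_right_distrib scaleR_right_distrib linear_cmul)
    then obtain C where C: "C \<subseteq> ?E m" "pairwise orthogonal C" "\<And>x. x \<in> C \<Longrightarrow> norm x = 1"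
        "independent C" "card C = dim (?E m)"
      by (rule orthonormal_basis_subspace) auto
    have "finite C" using C(4) by (rule independent_imp_finite)
    moreover have "card (?I m) = card C" using A C(5) by (simp add: sorted_eigenvalues_def)
    moreover have "finite (?I m)" by simp
    ultimately obtain f where "bij_betw f (?I m) C"
      using finite_same_card_bij by blast
    then show ?thesis using C by (intro exI[of _ f]) (auto simp: bij_betw_def good_def)
  qed
  \<comment> \<open>One family is chosen per value \<open>m\<close> and not per index: indices with
    equal \<open>\<mu>\<close> have to draw distinct vectors from the same orthonormal
    basis.\<close>
  define f where "f m = (SOME f. good m f)" for m
  have "good m (f m)" for m
    unfolding f_def using ex[of m] by (rule someI_ex)
  then have f: "inj_on (f m) (?I m)" "f m ` ?I m \<subseteq> ?E m"
      "pairwise orthogonal (f m ` ?I m)" "\<forall>x\<in>f m ` ?I m. norm x = 1" for m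
    unfolding good_def by simp_all
  define p where "p i = f (\<mu> i) i" for i
  have eig: "A *v p i = \<mu> i *\<^sub>R p i" if "i \<in> {1..CARD('d)}" for i
    using f(2)[of "\<mu> i"] that by (auto simp: p_def)
  have "p i \<bullet> p j = (if i = j then 1 else 0)" if ij: "i \<in> {1..CARD('d)}" "j \<in> {1..CARD('d)}" for i j
  proof (cases "\<mu> i = \<mu> j")
    case True
    show ?thesis
    proof (cases "i = j")
      case True
      then show ?thesis using f(4)[of "\<mu> i"] ij by (auto simp: p_def norm_eq_1)
    next
      case False
      have "f (\<mu> i) i \<noteq> f (\<mu> i) j"
        using inj_onD[OF f(1)[of "\<mu> i"], of i j] ij True False by auto
      then have "orthogonal (f (\<mu> i) i) (f (\<mu> i) j)"
        using ij True by (intro pairwiseD[OF f(3)[of "\<mu> i"]]) auto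
      then show ?thesis using False True by (simp add: p_def orthogonal_def)
    qed
  next
    case False
    have "\<mu> j * (p i \<bullet> p j) = \<mu> i * (p i \<bullet> p j)"
      using sym[of "p i" "p j"] unfolding eig[OF ij(1)] eig[OF ij(2)]
      by (simp only: inner_scaleR_left inner_scaleR_right)
    then show ?thesis using False by auto
  qed
  with eig have "orthonormal_eigenbasis A \<mu> p" by (simp add: orthonormal_eigenbasis_def)
  then show ?thesis by (rule that)
qed

text \<open>The dimension count behind the minimax principle. Index \<open>i\<close> belongs to both
  ranges \<open>{1..i}\<close> and \<open>{i..CARD('d)}\<close>, so the two dimensions add up to one
  more than that of the space and the spans share a nonzero vector. The conclusion records
  orthogonality to the remaining basis vectors, which is what the bounds on quadratic forms
  consume.\<close>

lemma eigen_subspaces_intersect: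
  fixes p q :: "nat \<Rightarrow> real^'d"
  assumes p: "orthonormal_basis p" and q: "orthonormal_basis q" and i: "i \<in> {1..CARD('d)}"
  obtains x where "norm x = 1"
    "\<And>j. j \<in> {1..CARD('d)} \<Longrightarrow> i < j \<Longrightarrow> q j \<bullet> x = 0"
    "\<And>j. j \<in> {1..CARD('d)} \<Longrightarrow> j < i \<Longrightarrow> p j \<bullet> x = 0"
proof -
  let ?S = "span (q ` {1..i})" and ?T = "span (p ` {i..CARD('d)})"
  have sub: "{1..i} \<subseteq> {1..CARD('d)}" "{i..CARD('d)} \<subseteq> {1..CARD('d)}" using i by auto
  have d: "dim (span (v ` J)) = card J"
    if v: "orthonormal_basis v" and J: "J \<subseteq> {1..CARD('d)}" for v :: "nat \<Rightarrow> real^'d" and J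
  proof -
    have "independent (v ` J)"
      by (rule independent_mono[OF orthonormal_basis_independent(2)[OF v] image_mono[OF J]])
    moreover have "card (v ` J) = card J"
      by (rule card_image[OF inj_on_subset[OF orthonormal_basis_independent(1)[OF v] J]])
    ultimately show ?thesis by (simp add: dim_eq_card_independent)
  qed
  have "dim {x + y |x y. x \<in> ?S \<and> y \<in> ?T} \<le> CARD('d)"
    using dim_subset_UNIV[of "{x + y |x y. x \<in> ?S \<and> y \<in> ?T}"] by simp
  moreover have "dim {x + y |x y. x \<in> ?S \<and> y \<in> ?T} + dim (?S \<inter> ?T) = i + (Suc (CARD('d)) - i)"
    using dim_sums_Int[OF subspace_span[of "q ` {1..i}"] subspace_span[of "p ` {i..CARD('d)}"]]
      d[OF q sub(1)] d[OF p sub(2)] by simp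
  ultimately have "dim (?S \<inter> ?T) \<noteq> 0"
    using i by linarith
  then have "\<not> ?S \<inter> ?T \<subseteq> {0}"
    by (simp add: dim_eq_0)
  then obtain z where z: "z \<in> ?S" "z \<in> ?T" "z \<noteq> 0"
    by auto
  have orth: "v j \<bullet> z = 0"
    if "orthonormal_basis v" "z \<in> span (v ` J)" "J \<subseteq> {1..CARD('d)}" "j \<in> {1..CARD('d)} - J"
    for v :: "nat \<Rightarrow> real^'d" and j J
  proof -
    have "orthogonal (v j) z"
    proof (rule orthogonal_to_span[OF that(2)])
      fix w assume "w \<in> v ` J"
      then obtain k where "k \<in> J" "w = v k" by auto
      then show "orthogonal (v j) w"
        using orthonormal_basis_inner[OF that(1), of j k] that(3,4) by (auto simp: orthogonal_def)
    qed
    then show ?thesis by (simp add: orthogonal_def)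
  qed
  show thesis
  proof (rule that[of "z /\<^sub>R norm z"])
    show "norm (z /\<^sub>R norm z) = 1" using z(3) by simp
    show "q j \<bullet> (z /\<^sub>R norm z) = 0" if "j \<in> {1..CARD('d)}" "i < j" for j
      using orth[OF q z(1) sub(1), of j] that by simp
    show "p j \<bullet> (z /\<^sub>R norm z) = 0" if "j \<in> {1..CARD('d)}" "j < i" for j
      using orth[OF p z(2) sub(2), of j] that by simp
  qed
qed

text \<open>At a unit vector the quadratic form is the mean of the eigenvalues with weights
  \<open>(v i \<bullet> x)\<^sup>2\<close>, so only eigenvalues of nonzero weight count.\<close>

lemma eigenbasis_quad_form_le:
  fixes A :: "real^'d^'d"
  assumes A: "orthonormal_eigenbasis A \<mu> v" and x: "norm x = 1"
    and le: "\<And>i. i \<in> {1..CARD('d)} \<Longrightarrow> v i \<bullet> x \<noteq> 0 \<Longrightarrow> \<mu> i \<le> c"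
  shows "quad_form A x \<le> c"
proof -
  have "quad_form A x \<le> (\<Sum>i = 1..CARD('d). c * (v i \<bullet> x)\<^sup>2)"
    unfolding eigenbasis_quad_form[OF A]
  proof (rule sum_mono)
    fix i assume "i \<in> {1..CARD('d)}"
    then show "\<mu> i * (v i \<bullet> x)\<^sup>2 \<le> c * (v i \<bullet> x)\<^sup>2"
      using le by (cases "v i \<bullet> x = 0") (auto intro: mult_right_mono)
  qed
  also have "\<dots> = c * (norm x)\<^sup>2"
    unfolding orthonormal_basis_norm_sq[OF orthonormal_eigenbasis_basis[OF A]]
    by (rule sum_distrib_left[symmetric])
  finally show ?thesis using x by simp
qed

lemma eigenbasis_quad_form_ge:
  fixes A :: "real^'d^'d"
  assumes A: "orthonormal_eigenbasis A \<mu> v" and x: "norm x = 1"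
    and le: "\<And>i. i \<in> {1..CARD('d)} \<Longrightarrow> v i \<bullet> x \<noteq> 0 \<Longrightarrow> c \<le> \<mu> i"
  shows "c \<le> quad_form A x"
proof -
  have "c * (norm x)\<^sup>2 = (\<Sum>i = 1..CARD('d). c * (v i \<bullet> x)\<^sup>2)"
    unfolding orthonormal_basis_norm_sq[OF orthonormal_eigenbasis_basis[OF A]]
    by (rule sum_distrib_left)
  also have "\<dots> \<le> quad_form A x"
    unfolding eigenbasis_quad_form[OF A]
  proof (rule sum_mono)
    fix i assume "i \<in> {1..CARD('d)}"
    then show "c * (v i \<bullet> x)\<^sup>2 \<le> \<mu> i * (v i \<bullet> x)\<^sup>2"
      using le by (cases "v i \<bullet> x = 0") (auto intro: mult_right_mono)
  qed
  finally show ?thesis using x by simp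
qed

lemma quad_form_diff: "quad_form (A - B) x = quad_form A x - quad_form B x"
  by (simp add: quad_form_def matrix_vector_mult_diff_rdistrib inner_diff_right)

section \<open>Shrinking the eigenvalues\<close>

text \<open>At the common vector \<open>x\<close> of \<open>eigen_subspaces_intersect\<close>, the
  form of \<open>G\<close> is at most \<open>lam i\<close> and that of \<open>H\<close> at least
  \<open>\<mu> i\<close>. The condition \<open>lip\<close> makes \<open>t - b t\<close>
  nondecreasing, so \<open>\<mu> i - b (\<mu> i)\<close> is at most
  \<open>quad_form H x - b (quad_form H x)\<close>, and \<open>dev\<close> compares this with
  \<open>G\<close>.\<close>

lemma shrunk_eigenvalue_le:
  fixes G H :: "real^'d^'d"
  assumes G: "orthonormal_eigenbasis G lam p" "antimono_on {1..CARD('d)} lam"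
    and H: "orthonormal_eigenbasis H \<mu> q" "antimono_on {1..CARD('d)} \<mu>"
    and lip: "\<And>s t. s \<le> t \<Longrightarrow> b t - b s \<le> t - s"
    and dev: "\<And>x. norm x = 1 \<Longrightarrow> quad_form H x - b (quad_form H x) \<le> quad_form G x"
    and i: "i \<in> {1..CARD('d)}"
  shows "\<mu> i - b (\<mu> i) \<le> lam i"
proof -
  obtain x where x: "norm x = 1"
    and xq: "\<And>j. j \<in> {1..CARD('d)} \<Longrightarrow> i < j \<Longrightarrow> q j \<bullet> x = 0"
    and xp: "\<And>j. j \<in> {1..CARD('d)} \<Longrightarrow> j < i \<Longrightarrow> p j \<bullet> x = 0"
    using eigen_subspaces_intersect[OF orthonormal_eigenbasis_basis[OF G(1)]
        orthonormal_eigenbasis_basis[OF H(1)] i] by blast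
  have "quad_form G x \<le> lam i"
  proof (rule eigenbasis_quad_form_le[OF G(1) x])
    fix j assume j: "j \<in> {1..CARD('d)}" "p j \<bullet> x \<noteq> 0"
    then have "i \<le> j" using xp[of j] by force
    then show "lam j \<le> lam i" using monotone_onD[OF G(2) i j(1)] by simp
  qed
  moreover have "\<mu> i \<le> quad_form H x"
  proof (rule eigenbasis_quad_form_ge[OF H(1) x])
    fix j assume j: "j \<in> {1..CARD('d)}" "q j \<bullet> x \<noteq> 0"
    then have "j \<le> i" using xq[of j] by force
    then show "\<mu> i \<le> \<mu> j" using monotone_onD[OF H(2) j(1) i] by simp
  qed
  ultimately show ?thesis using lip[of "\<mu> i" "quad_form H x"] dev[OF x] by linarith
qed

section \<open>The Frobenius norm of the error\<close>

lemma sum_bessel_le: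
  fixes p :: "nat \<Rightarrow> real^'d"
  assumes p: "orthonormal_basis p" and J: "J \<subseteq> {1..CARD('d)}"
  shows "(\<Sum>j\<in>J. (p j \<bullet> x)\<^sup>2) \<le> (norm x)\<^sup>2"
  unfolding orthonormal_basis_norm_sq[OF p] using J by (intro sum_mono2) auto

text \<open>The entries are cut into the first \<open>r\<close> rows, the first \<open>r\<close>
  columns of the other rows, and the remaining block. A full row or column sum is the squared norm
  of the image of a unit vector, so the first two regions cost \<open>real r * c\<^sup>2\<close>
  each.\<close>

lemma frobenius_diff_le:
  fixes G T :: "real^'d^'d"
  assumes G: "orthonormal_eigenbasis G lam p" and T: "orthonormal_eigenbasis T \<mu> q"
    and mu: "\<And>i. i \<in> {1..CARD('d)} \<Longrightarrow> 0 \<le> \<mu> i \<and> \<mu> i \<le> lam i"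
    and op: "\<And>x. norm x = 1 \<Longrightarrow> norm ((G - T) *v x) \<le> c"
    and r: "r \<in> {1..CARD('d)}"
  shows "(frobenius (G - T))\<^sup>2 \<le> 2 * real r * c\<^sup>2 + 2 * (\<Sum>i = r + 1..CARD('d). (lam i)\<^sup>2)"
proof -
  let ?D = "{1..CARD('d)}" and ?L = "{1..r}" and ?H = "{r + 1..CARD('d)}"
  define e where "e i j = (lam i - \<mu> j)\<^sup>2 * (q j \<bullet> p i)\<^sup>2" for i j
  have e0: "0 \<le> e i j" for i j by (simp add: e_def)
  have D: "?D = ?L \<union> ?H" "?L \<inter> ?H = {}" using r by auto
  then have HD: "?H \<subseteq> ?D" and LD: "?L \<subseteq> ?D" by blast+
  note p = orthonormal_eigenbasis_basis[OF G] and q = orthonormal_eigenbasis_basis[OF T]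
  note np = orthonormal_basis_norm[OF p] and nq = orthonormal_basis_norm[OF q]
  note fr = frobenius_eigenbases[OF G T, folded e_def]
  have split: "(\<Sum>i\<in>?D. f i) = (\<Sum>i\<in>?L. f i) + (\<Sum>i\<in>?H. f i)" for f :: "nat \<Rightarrow> real"
    unfolding D(1) by (rule sum.union_disjoint) (use D(2) in auto)
  have c0: "0 \<le> c" using op[OF np[OF r]] norm_ge_zero order_trans by blast
  have rows: "(\<Sum>j\<in>?D. e i j) \<le> c\<^sup>2" if "i \<in> ?D" for i
    unfolding fr(2)[OF that, symmetric] by (intro power_mono op np that) simp
  have cols: "(\<Sum>i\<in>?D. e i j) \<le> c\<^sup>2" if "j \<in> ?D" for j
    unfolding fr(3)[OF that, symmetric] by (intro power_mono op nq that) simp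
  have low: "(\<Sum>i\<in>?L. \<Sum>j\<in>?D. e i j) \<le> real r * c\<^sup>2"
    using sum_bounded_above[of ?L "\<lambda>i. \<Sum>j\<in>?D. e i j" "c\<^sup>2"] rows LD by auto
  have "(\<Sum>i\<in>?H. \<Sum>j\<in>?L. e i j) = (\<Sum>j\<in>?L. \<Sum>i\<in>?H. e i j)" by (rule sum.swap)
  also have "\<dots> \<le> (\<Sum>j\<in>?L. \<Sum>i\<in>?D. e i j)"
    using HD e0 by (intro sum_mono sum_mono2) auto
  also have "\<dots> \<le> real r * c\<^sup>2"
    using sum_bounded_above[of ?L "\<lambda>j. \<Sum>i\<in>?D. e i j" "c\<^sup>2"] cols LD by auto
  finally have mid: "(\<Sum>i\<in>?H. \<Sum>j\<in>?L. e i j) \<le> real r * c\<^sup>2" .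
  have "(\<Sum>i\<in>?H. \<Sum>j\<in>?H. e i j)
      \<le> (\<Sum>i\<in>?H. \<Sum>j\<in>?H. (lam i)\<^sup>2 * (q j \<bullet> p i)\<^sup>2 + (\<mu> j)\<^sup>2 * (q j \<bullet> p i)\<^sup>2)"
  proof (intro sum_mono)
    fix i j assume ij: "i \<in> ?H" "j \<in> ?H"
    have "0 \<le> \<mu> i" "\<mu> i \<le> lam i" "0 \<le> \<mu> j" using ij HD mu by blast+
    \<comment> \<open>Nonnegativity of both spectra lets the cross term of the square be
      dropped.\<close>
    then have "0 \<le> lam i * \<mu> j" by simp
    then have "(lam i - \<mu> j)\<^sup>2 \<le> (lam i)\<^sup>2 + (\<mu> j)\<^sup>2" by (simp add: power2_diff mult.commute)
    then show "e i j \<le> (lam i)\<^sup>2 * (q j \<bullet> p i)\<^sup>2 + (\<mu> j)\<^sup>2 * (q j \<bullet> p i)\<^sup>2"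
      unfolding e_def distrib_right[symmetric] by (rule mult_right_mono) simp
  qed
  \<comment> \<open>The two terms are summed in opposite orders, so that Bessel's inequality applies
    to \<open>p i\<close> in the basis \<open>q\<close> and to \<open>q j\<close> in the basis
    \<open>p\<close>.\<close>
  also have "\<dots> = (\<Sum>i\<in>?H. (lam i)\<^sup>2 * (\<Sum>j\<in>?H. (q j \<bullet> p i)\<^sup>2))
      + (\<Sum>j\<in>?H. (\<mu> j)\<^sup>2 * (\<Sum>i\<in>?H. (p i \<bullet> q j)\<^sup>2))"
    unfolding sum.distrib sum_distrib_left inner_commute[of "p _"]
    by (simp add: sum.swap[of "\<lambda>i j. (\<mu> j)\<^sup>2 * (q j \<bullet> p i)\<^sup>2"])
  also have "\<dots> \<le> (\<Sum>i\<in>?H. (lam i)\<^sup>2 * 1) + (\<Sum>j\<in>?H. (\<mu> j)\<^sup>2 * 1)"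
  proof (intro add_mono sum_mono mult_left_mono)
    fix i assume "i \<in> ?H"
    then have i: "i \<in> ?D" using HD by blast
    show "(\<Sum>j\<in>?H. (q j \<bullet> p i)\<^sup>2) \<le> 1" "(\<Sum>j\<in>?H. (p j \<bullet> q i)\<^sup>2) \<le> 1"
      using sum_bessel_le[OF q HD, of "p i"] sum_bessel_le[OF p HD, of "q i"]
      unfolding np[OF i] nq[OF i] by simp_all
  qed simp_all
  also have "\<dots> \<le> 2 * (\<Sum>i\<in>?H. (lam i)\<^sup>2)"
  proof -
    have "(\<Sum>j\<in>?H. (\<mu> j)\<^sup>2) \<le> (\<Sum>j\<in>?H. (lam j)\<^sup>2)"
      using mu HD by (intro sum_mono power_mono) blast+
    then show ?thesis by simp
  qed
  finally have high: "(\<Sum>i\<in>?H. \<Sum>j\<in>?H. e i j) \<le> 2 * (\<Sum>i\<in>?H. (lam i)\<^sup>2)" .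
  have "(frobenius (G - T))\<^sup>2 = (\<Sum>i\<in>?L. \<Sum>j\<in>?D. e i j)
      + ((\<Sum>i\<in>?H. \<Sum>j\<in>?L. e i j) + (\<Sum>i\<in>?H. \<Sum>j\<in>?H. e i j))"
    unfolding fr(1) split[of "\<lambda>i. \<Sum>j\<in>?D. e i j"] sum.distrib[symmetric] split[of "e _", symmetric]
    by (rule refl)
  then show ?thesis using low mid high by simp
qed

text \<open>The constant \<open>5 / 2\<close> in the operator norm is a sum: passing from
  \<open>G\<close> to \<open>H\<close> costs \<open>b (lam 1)\<close>, since \<open>lam 1\<close>
  bounds the form of \<open>G\<close> and \<open>b\<close> is nondecreasing, and shrinking the
  eigenvalues of \<open>H\<close> costs at most \<open>3 / 2\<close> times as much.\<close>

lemma frobenius_shrunk_estimator_le: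
  fixes G H :: "real^'d^'d"
  assumes G: "orthonormal_eigenbasis G lam p" "antimono_on {1..CARD('d)} lam"
    and H: "orthonormal_eigenbasis H \<mu> q" "antimono_on {1..CARD('d)} \<mu>"
    and psd: "\<And>x. norm x = 1 \<Longrightarrow> 0 \<le> quad_form G x" "\<And>x. norm x = 1 \<Longrightarrow> 0 \<le> quad_form H x"
    and b0: "\<And>t. 0 \<le> b t" and bmono: "\<And>s t. s \<le> t \<Longrightarrow> b s \<le> b t"
    and blip: "\<And>s t. s \<le> t \<Longrightarrow> b t - b s \<le> (t - s) / 2"
    and dev: "\<And>x. norm x = 1 \<Longrightarrow> \<bar>quad_form H x - quad_form G x\<bar> \<le> b (quad_form G x)"
      "\<And>x. norm x = 1 \<Longrightarrow> \<bar>quad_form H x - quad_form G x\<bar> \<le> b (quad_form H x)"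
    and r: "r \<in> {1..CARD('d)}"
  shows "(frobenius (G - spectral_sum (\<lambda>i. max (\<mu> i - b (\<mu> i)) 0) q))\<^sup>2
    \<le> 13 * real r * (b (lam 1))\<^sup>2 + 2 * (\<Sum>i = r + 1..CARD('d). (lam i)\<^sup>2)"
proof -
  let ?D = "{1..CARD('d)}"
  define \<nu> where "\<nu> i = max (\<mu> i - b (\<mu> i)) 0" for i
  define T where "T = spectral_sum \<nu> q"
  define B where "B = b (lam 1)"
  have B0: "0 \<le> B" by (simp add: B_def b0)
  have one: "1 \<in> ?D" by (simp add: One_nat_def)
  note p = orthonormal_eigenbasis_basis[OF G(1)] and q = orthonormal_eigenbasis_basis[OF H(1)]
  have T: "orthonormal_eigenbasis T \<nu> q" unfolding T_def by (rule spectral_sum_eigenbasis[OF q])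
  have lam0: "0 \<le> lam i" if "i \<in> ?D" for i
    using psd(1)[OF orthonormal_basis_norm[OF p that]]
    by (simp only: eigenbasis_quad_form_eigenvector[OF G(1) that])
  have mu0: "0 \<le> \<mu> i" if "i \<in> ?D" for i
    using psd(2)[OF orthonormal_basis_norm[OF q that]]
    by (simp only: eigenbasis_quad_form_eigenvector[OF H(1) that])
  have Gle: "quad_form G x \<le> lam 1" if "norm x = 1" for x
  proof (rule eigenbasis_quad_form_le[OF G(1) that])
    show "lam i \<le> lam 1" if "i \<in> ?D" for i
      using monotone_onD[OF G(2) one that] that by simp
  qed
  have nu: "0 \<le> \<nu> i \<and> \<nu> i \<le> lam i" if i: "i \<in> ?D" for i
  proof -
    have "\<mu> i - b (\<mu> i) \<le> lam i"
    proof (rule shrunk_eigenvalue_le[OF G H _ _ i])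
      show "b t - b s \<le> t - s" if "s \<le> t" for s t using blip[OF that] that by simp
      show "quad_form H x - b (quad_form H x) \<le> quad_form G x" if "norm x = 1" for x
        using dev(2)[OF that] by linarith
    qed
    then show ?thesis using lam0[OF i] by (simp add: \<nu>_def)
  qed
  have gap: "0 \<le> \<mu> i - \<nu> i \<and> \<mu> i - \<nu> i \<le> 3 / 2 * B" if i: "i \<in> ?D" for i
  proof -
    have x: "norm (q i) = 1" by (rule orthonormal_basis_norm[OF q i])
    have "\<mu> i - quad_form G (q i) \<le> b (quad_form G (q i))"
      using dev(1)[OF x] eigenbasis_quad_form_eigenvector[OF H(1) i] by linarith
    also have "\<dots> \<le> B" unfolding B_def by (rule bmono[OF Gle[OF x]])
    finally have le: "\<mu> i \<le> lam 1 + B" using Gle[OF x] by linarith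
    have "b (\<mu> i) \<le> b (lam 1 + B)" by (rule bmono[OF le])
    \<comment> \<open>An eigenvalue of \<open>H\<close> may exceed \<open>lam 1\<close> by
      \<open>B\<close>, which raises \<open>b\<close> by at most \<open>B / 2\<close>.\<close>
    also have "\<dots> \<le> 3 / 2 * B" using blip[of "lam 1" "lam 1 + B"] B0 by (simp add: B_def)
    \<comment> \<open>Where the maximum is 0 the gap is \<open>\<mu> i\<close> itself, nonnegative
      and at most \<open>b (\<mu> i)\<close>.\<close>
    finally show ?thesis using mu0[OF i] b0[of "\<mu> i"] by (auto simp: \<nu>_def max_def)
  qed
  have quad: "\<bar>quad_form (G - T) x\<bar> \<le> 5 / 2 * B" if x: "norm x = 1" for x
  proof -
    have "\<bar>quad_form H x - quad_form G x\<bar> \<le> B"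
      using dev(1)[OF x] bmono[OF Gle[OF x]] unfolding B_def by linarith
    moreover have HT: "quad_form H x - quad_form T x = (\<Sum>i\<in>?D. (\<mu> i - \<nu> i) * (q i \<bullet> x)\<^sup>2)"
      unfolding eigenbasis_quad_form[OF H(1)] eigenbasis_quad_form[OF T]
      by (simp add: sum_subtractf left_diff_distrib)
    moreover have "0 \<le> (\<Sum>i\<in>?D. (\<mu> i - \<nu> i) * (q i \<bullet> x)\<^sup>2)"
      using gap by (intro sum_nonneg mult_nonneg_nonneg) auto
    moreover have "(\<Sum>i\<in>?D. (\<mu> i - \<nu> i) * (q i \<bullet> x)\<^sup>2) \<le> (\<Sum>i\<in>?D. 3 / 2 * B * (q i \<bullet> x)\<^sup>2)"
      using gap by (intro sum_mono mult_right_mono) auto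
    moreover have "(\<Sum>i\<in>?D. 3 / 2 * B * (q i \<bullet> x)\<^sup>2) = 3 / 2 * B"
      unfolding sum_distrib_left[symmetric] orthonormal_basis_norm_sq[OF q, symmetric] x by simp
    ultimately show ?thesis unfolding quad_form_diff using B0 by linarith
  qed
  have "norm ((G - T) *v x) \<le> 5 / 2 * B" if x: "norm x = 1" for x
  proof -
    have "norm ((G - T) *v x) \<le> 5 / 2 * B * norm x"
    proof (rule norm_mult_le_of_quad_form_le[OF _ quad])
      show "y \<bullet> ((G - T) *v z) = ((G - T) *v y) \<bullet> z" for y z
        by (simp add: matrix_vector_mult_diff_rdistrib inner_diff_left inner_diff_right
            eigenbasis_self_adjoint[OF G(1)] eigenbasis_self_adjoint[OF T])
    qed
    then show ?thesis using x by simp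
  qed
  from frobenius_diff_le[OF G(1) T nu this r]
  have "(frobenius (G - T))\<^sup>2
      \<le> 2 * real r * (5 / 2 * B)\<^sup>2 + 2 * (\<Sum>i = r + 1..CARD('d). (lam i)\<^sup>2)" .
  \<comment> \<open>The exact constant is \<open>2 * (5 / 2)\<^sup>2 = 25 / 2\<close>, rounded up to
    13.\<close>
  moreover have "2 * real r * (5 / 2 * B)\<^sup>2 \<le> 13 * real r * B\<^sup>2"
    by (simp add: power_mult_distrib power_divide mult_right_mono)
  ultimately show ?thesis unfolding T_def \<nu>_def B_def by linarith
qed

section \<open>The deviation rate\<close>

lemma div_one_minus_mono:
  fixes u w :: real
  assumes "0 \<le> u" "u \<le> w" "w \<le> 1 / 8"
  shows "u / (1 - 4 * u) \<le> w / (1 - 4 * w)"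
  using assms by (intro frac_le) auto

text \<open>This makes \<open>t * (z t / (1 - 4 * z t))\<close> nondecreasing even though
  \<open>z\<close> is nonincreasing. The cross-multiplied claim is \<open>sq\<close> times the
  inequality \<open>uw\<close>, divided by \<open>u * w\<close>; hence the separate case
  \<open>w = 0\<close>.\<close>

lemma mult_div_one_minus_mono:
  fixes s t u w :: real
  assumes s: "0 < s" "0 < t" and u: "0 \<le> u" "u \<le> w" "w \<le> 1 / 8" and sq: "s * w\<^sup>2 \<le> t * u\<^sup>2"
  shows "s * (w / (1 - 4 * w)) \<le> t * (u / (1 - 4 * u))"
proof (cases "w = 0")
  case True
  then show ?thesis using u by simp
next
  case False
  then have w: "0 < w" using u by simp
  have "0 < s * w\<^sup>2" using s w by simp
  then have "u \<noteq> 0" using sq by auto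
  then have u': "0 < u" using u by simp
  \<comment> \<open>The parabola \<open>v * (1 - 4 * v)\<close> increases exactly up to its vertex
    \<open>1 / 8\<close>, the source of the bound on \<open>w\<close>.\<close>
  have "0 \<le> (w - u) * (1 - 4 * (w + u))" using u by (intro mult_nonneg_nonneg) auto
  then have uw: "u * (1 - 4 * u) \<le> w * (1 - 4 * w)" by (simp add: algebra_simps)
  have "(s * w * (1 - 4 * u)) * (u * w) = (s * w\<^sup>2) * (u * (1 - 4 * u))"
    by (simp add: power2_eq_square ac_simps)
  also have "\<dots> \<le> (t * u\<^sup>2) * (w * (1 - 4 * w))"
    using sq uw u s by (intro mult_mono[OF sq uw]) auto
  also have "\<dots> = (t * u * (1 - 4 * w)) * (u * w)"
    by (simp add: power2_eq_square ac_simps)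
  finally have "s * w * (1 - 4 * u) \<le> t * u * (1 - 4 * w)"
    using u' w by (simp add: mult_le_cancel_right)
  then show ?thesis using u by (simp add: divide_simps)
qed

text \<open>The bound \<open>2 t z(t) / (1 - 4 z(t))\<close> is extended by a constant below \<open>\<sigma>\<close> and linearly beyond
  \<open>S\<close>. Its slope is at most \<open>1/2\<close> because \<open>z / (1 - 4 z) \<le> 1/4\<close> for \<open>z \<le> 1/8\<close>.\<close>

lemma rate_mono_lipschitz:
  fixes z F :: "real \<Rightarrow> real"
  assumes \<sigma>: "0 < \<sigma>" "\<sigma> \<le> S"
    and z0: "\<And>t. \<sigma> \<le> t \<Longrightarrow> 0 \<le> z t" and z8: "z \<sigma> \<le> 1 / 8"
    and zanti: "\<And>s t. \<sigma> \<le> s \<Longrightarrow> s \<le> t \<Longrightarrow> z t \<le> z s"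
    and zsq: "\<And>s t. \<sigma> \<le> s \<Longrightarrow> s \<le> t \<Longrightarrow> s * (z s)\<^sup>2 \<le> t * (z t)\<^sup>2"
    and F: "\<And>t. F t = 2 * max t \<sigma> * (z (max (min t S) \<sigma>) / (1 - 4 * z (max (min t S) \<sigma>)))"
    and st: "s \<le> t"
  shows "0 \<le> F s" and "F s \<le> F t" and "F t - F s \<le> (t - s) / 2"
proof -
  define h where "h t = z t / (1 - 4 * z t)" for t
  \<comment> \<open>Truncation from below at \<open>\<sigma>\<close> does not increase distances, so
    it is enough to work where \<open>z\<close> is controlled.\<close>
  define x y where "x = max s \<sigma>" and "y = max t \<sigma>"
  have xy: "\<sigma> \<le> x" "x \<le> y" "y - x \<le> t - s" using st by (auto simp: x_def y_def)
  have x0: "0 < x" "0 < y" using xy \<sigma> by auto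
  have "max (min s S) \<sigma> = min x S" "max (min t S) \<sigma> = min y S"
    using \<sigma> by (auto simp: x_def y_def)
  then have Fx: "F s = 2 * x * h (min x S)" and Fy: "F t = 2 * y * h (min y S)"
    by (simp_all add: F h_def x_def y_def)
  have z8': "z v \<le> 1 / 8" if "\<sigma> \<le> v" for v using zanti[OF order_refl that] z8 by simp
  have h0: "0 \<le> h v" if "\<sigma> \<le> v" for v
    using z0[OF that] z8'[OF that] by (simp add: h_def)
  have h4: "h v \<le> 1 / 4" if "\<sigma> \<le> v" for v
    using div_one_minus_mono[OF z0[OF that] z8'[OF that]] by (simp add: h_def)
  have hanti: "h w \<le> h v" if "\<sigma> \<le> v" "v \<le> w" for v w
    unfolding h_def using that by (intro div_one_minus_mono z0 zanti z8') auto
  have hmono: "v * h v \<le> w * h w" if "\<sigma> \<le> v" "v \<le> w" for v w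
    unfolding h_def using that \<sigma> by (intro mult_div_one_minus_mono z0 zanti z8' zsq) auto
  show "0 \<le> F s" unfolding Fx using h0[of "min x S"] x0 xy \<sigma> by simp
  show "F s \<le> F t"
  proof (cases "y \<le> S")
    case True
    then show ?thesis unfolding Fx Fy using hmono[OF xy(1,2)] xy by (simp add: min_def)
  next
    case False
    have "x * h (min x S) \<le> y * h S"
    proof (cases "x \<le> S")
      case True
      have "x * h x \<le> S * h S" by (rule hmono[OF xy(1) True])
      also have "\<dots> \<le> y * h S" using False h0[OF \<sigma>(2)] by (intro mult_right_mono) auto
      finally show ?thesis using True by (simp add: min_def)
    next
      case False
      then show ?thesis using xy h0[OF \<sigma>(2)] by (simp add: min_def mult_right_mono)
    qed
    then show ?thesis unfolding Fx Fy using False by (simp add: min_def)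
  qed
  \<comment> \<open>Since \<open>h\<close> is nonincreasing, the increment of \<open>F\<close> is at
    most that of the linear factor with \<open>h\<close> frozen at the left end.\<close>
  have "y * h (min y S) \<le> y * h (min x S)"
    using x0 xy \<sigma> by (intro mult_left_mono hanti) auto
  then have "F t - F s \<le> 2 * ((y - x) * h (min x S))"
    unfolding Fx Fy by (simp add: algebra_simps)
  also have "\<dots> \<le> 2 * ((y - x) * (1 / 4))"
    using xy \<sigma> by (intro mult_left_mono h4) auto
  also have "\<dots> \<le> (t - s) / 2" using xy by simp
  finally show "F t - F s \<le> (t - s) / 2" .
qed

section \<open>Monotonicity of \<open>zeta\<close> and finiteness of the bound\<close>

lemma const_c_pos: "0 < const_c"
  unfolding const_c_def by (intro mult_pos_pos divide_pos_pos) auto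

lemma s4_sq_nonneg: "0 \<le> s4_sq M X"
  by (simp add: s4_sq_def)

text \<open>The argument of the logarithm may be negative when \<open>n\<close> is small, but \<open>const_K\<close> is an integer
  and \<open>ln x = ln \<bar>x\<bar>\<close>, \<open>ln 0 = 0\<close>.\<close>

lemma ln_int_div_nonneg:
  fixes k :: int
  assumes "0 < \<epsilon>" "\<epsilon> < 1"
  shows "0 \<le> ln (real_of_int k / \<epsilon>)"
proof (cases "k = 0")
  case False
  have "ln (real_of_int k / \<epsilon>) = ln \<bar>real_of_int k / \<epsilon>\<bar>"
    by (simp add: abs_if ln_minus del: minus_divide_left)
  moreover have "1 \<le> \<bar>real_of_int k\<bar>" using False by linarith
  then have "1 \<le> \<bar>real_of_int k / \<epsilon>\<bar>" using assms by (simp add: divide_simps)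
  ultimately show ?thesis by simp
qed simp

text \<open>As a function of \<open>t\<close>, \<open>zeta\<close> is
  \<open>sqrt (\<alpha> / t + \<beta>) * c + sqrt (\<gamma> / t) * d\<close> with nonnegative
  coefficients, hence nonincreasing. Multiplied by \<open>sqrt t\<close> it becomes
  \<open>sqrt (\<alpha> + \<beta> * t) * c + sqrt \<gamma> * d\<close>, which is
  nondecreasing.\<close>

lemma zeta_properties:
  assumes "0 < \<epsilon>" "\<epsilon> < 1" and \<kappa>: "1 \<le> kurtosis M X" and s: "0 < s" "s \<le> t"
  shows "0 \<le> zeta M X a \<epsilon> n t"
    and "zeta M X a \<epsilon> n t \<le> zeta M X a \<epsilon> n s"
    and "s * (zeta M X a \<epsilon> n s)\<^sup>2 \<le> t * (zeta M X a \<epsilon> n t)\<^sup>2"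
proof -
  let ?\<kappa> = "kurtosis M X"
  define \<alpha> where "\<alpha> = 2 * (?\<kappa> - 1) * ((2 + 3 * const_c) * s4_sq M X / (4 * (2 + const_c) * sqrt ?\<kappa>))"
  define \<beta> where "\<beta> = 2 * (?\<kappa> - 1) * ln (real_of_int (const_K M X a n) / \<epsilon>)"
  define \<gamma> where "\<gamma> = 2 * (2 + const_c) * sqrt ?\<kappa> * s4_sq M X"
  define c d where "c = cosh (a / 4)" and "d = cosh (a / 2)"
  have cd: "0 \<le> c" "0 \<le> d" by (simp_all add: c_def d_def)
  have \<alpha>: "0 \<le> \<alpha>" and \<gamma>: "0 \<le> \<gamma>" and \<beta>: "0 \<le> \<beta>"
    using const_c_pos s4_sq_nonneg[of M X] \<kappa> ln_int_div_nonneg[OF assms(1,2)]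
    by (auto simp: \<alpha>_def \<beta>_def \<gamma>_def)
  have z: "zeta M X a \<epsilon> n v = sqrt (\<alpha> / v + \<beta>) * c + sqrt (\<gamma> / v) * d" for v
    unfolding zeta_def \<alpha>_def \<beta>_def \<gamma>_def c_def d_def by (simp add: distrib_left)
  have zsq: "v * (zeta M X a \<epsilon> n v)\<^sup>2 = (sqrt (\<alpha> + \<beta> * v) * c + sqrt \<gamma> * d)\<^sup>2" if v: "0 < v" for v
  proof -
    have "sqrt v * zeta M X a \<epsilon> n v = sqrt (v * (\<alpha> / v + \<beta>)) * c + sqrt (v * (\<gamma> / v)) * d"
      unfolding z real_sqrt_mult by (simp add: algebra_simps)
    also have "\<dots> = sqrt (\<alpha> + \<beta> * v) * c + sqrt \<gamma> * d"
      using v by (simp add: distrib_left mult.commute)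
    finally have "(sqrt v)\<^sup>2 * (zeta M X a \<epsilon> n v)\<^sup>2 = (sqrt (\<alpha> + \<beta> * v) * c + sqrt \<gamma> * d)\<^sup>2"
      by (simp only: power_mult_distrib[symmetric])
    then show ?thesis using v by simp
  qed
  have t: "0 < t" using s by simp
  show "0 \<le> zeta M X a \<epsilon> n t" unfolding z using \<alpha> \<beta> \<gamma> cd t by simp
  show "zeta M X a \<epsilon> n t \<le> zeta M X a \<epsilon> n s"
    unfolding z using \<alpha> \<beta> \<gamma> cd s
    by (intro add_mono mult_right_mono real_sqrt_le_mono divide_left_mono) auto
  show "s * (zeta M X a \<epsilon> n s)\<^sup>2 \<le> t * (zeta M X a \<epsilon> n t)\<^sup>2"
    unfolding zsq[OF s(1)] zsq[OF t] using \<alpha> \<beta> \<gamma> cd s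
    by (intro power_mono add_mono mult_right_mono real_sqrt_le_mono mult_left_mono) auto
qed

text \<open>Because \<open>zeta\<close> is nonincreasing, \<open>small\<close> puts every truncated
  argument into the finite branch of \<open>B_star\<close>, and the bound becomes a real function
  \<open>b\<close>. The second property isolates \<open>b t - \<sigma>\<close>, the right-hand side
  of the deviation inequality; the extra \<open>\<sigma>\<close> will pay for truncation at
  \<open>\<sigma>\<close>.\<close>

lemma B_bound_finite:
  fixes X :: "'a \<Rightarrow> real^'d"
  assumes \<epsilon>: "0 < \<epsilon>" "\<epsilon> < 1" and \<kappa>: "3 / 2 \<le> kurtosis M X"
    and \<sigma>: "0 < \<sigma>" "\<sigma> \<le> s4_sq M X" and "0 < \<delta>" and n: "1 \<le> n"
    and small: "8 * zeta M X a \<epsilon> n \<sigma> \<le> sqrt (real n)"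
  obtains b where "\<And>t. B_bound M X a \<epsilon> n \<sigma> \<delta> t = ereal (b t)"
    and "\<And>t. ereal (2 * max t \<sigma>) * B_star M X a \<epsilon> n \<sigma> (min t (s4_sq M X))
        + ereal (7 * \<delta> * frobenius (gram M X)) = ereal (b t - \<sigma>)"
    and "\<And>t. 0 \<le> b t" and "\<And>s t. s \<le> t \<Longrightarrow> b s \<le> b t"
    and "\<And>s t. s \<le> t \<Longrightarrow> b t - b s \<le> (t - s) / 2"
proof -
  define z where "z t = zeta M X a \<epsilon> n t / sqrt (real n)" for t
  let ?m = "\<lambda>t. max (min t (s4_sq M X)) \<sigma>"
  define F where "F t = 2 * max t \<sigma> * (z (?m t) / (1 - 4 * z (?m t)))" for t
  define D where "D = 7 * \<delta> * frobenius (gram M X)"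
  define b where "b t = F t + D + \<sigma>" for t
  have n0: "0 < sqrt (real n)" using n by simp
  have \<kappa>1: "1 \<le> kurtosis M X" using \<kappa> by simp
  note zp = zeta_properties[OF \<epsilon> \<kappa>1, of _ _ a n]
  have star: "B_star M X a \<epsilon> n \<sigma> (min t (s4_sq M X)) = ereal (z (?m t) / (1 - 4 * z (?m t)))" for t
  proof -
    \<comment> \<open>Kurtosis at least \<open>3 / 2\<close> makes the inverse at most 2; this
      matches the factor 8 in \<open>small\<close>.\<close>
    have "6 + inverse (kurtosis M X - 1) \<le> 8"
      using \<kappa> by (simp add: inverse_eq_divide divide_simps)
    then have "(6 + inverse (kurtosis M X - 1)) * zeta M X a \<epsilon> n (?m t) \<le> 8 * zeta M X a \<epsilon> n \<sigma>"
      using zp[of \<sigma> "?m t"] \<sigma> by (intro mult_mono) auto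
    then show ?thesis using small by (simp add: B_star_def z_def)
  qed
  have F: "0 \<le> F s" "F s \<le> F t" "F t - F s \<le> (t - s) / 2" if "s \<le> t" for s t
  proof -
    have z0: "0 \<le> z v" if "\<sigma> \<le> v" for v
      using zp(1)[of \<sigma> v] that \<sigma> n0 by (simp add: z_def)
    have z8: "z \<sigma> \<le> 1 / 8" using small n0 by (simp add: z_def divide_simps)
    have zanti: "z w \<le> z v" if "\<sigma> \<le> v" "v \<le> w" for v w
      using zp(2)[of v w] that \<sigma> n0 by (simp add: z_def divide_right_mono)
    have zsq: "v * (z v)\<^sup>2 \<le> w * (z w)\<^sup>2" if "\<sigma> \<le> v" "v \<le> w" for v w
      using zp(3)[of v w] that \<sigma> n0 by (simp add: z_def power_divide divide_right_mono)
    show "0 \<le> F s" "F s \<le> F t" "F t - F s \<le> (t - s) / 2"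
      using rate_mono_lipschitz[OF \<sigma> z0 z8 zanti zsq F_def that] by blast+
  qed
  have D0: "0 \<le> D" using \<open>0 < \<delta>\<close> frobenius_nonneg[of "gram M X"] by (simp add: D_def)
  have dev: "ereal (2 * max t \<sigma>) * B_star M X a \<epsilon> n \<sigma> (min t (s4_sq M X)) + ereal D
      = ereal (b t - \<sigma>)" for t
    by (simp add: star b_def F_def)
  show thesis
  proof (rule that[of b, OF _ dev[unfolded D_def]])
    show "B_bound M X a \<epsilon> n \<sigma> \<delta> t = ereal (b t)" for t
      unfolding B_bound_def dev[unfolded D_def] by simp
    show "0 \<le> b t" for t using F(1)[OF order_refl] D0 \<sigma> by (simp add: b_def)
    show "b s \<le> b t" if "s \<le> t" for s t using F(2)[OF that] by (simp add: b_def)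
    show "b t - b s \<le> (t - s) / 2" if "s \<le> t" for s t using F(3)[OF that] by (simp add: b_def)
  qed
qed

section \<open>The Gram matrix\<close>

lemma inner_outer_mult: "x \<bullet> (outer v *v y) = (x \<bullet> v) * (y \<bullet> v)"
  by (simp add: outer_mult_vector inner_commute)

text \<open>A linear functional passes under the integral once \<open>outer (X \<omega>)\<close> is
  integrable. Its norm is the squared norm of \<open>X \<omega>\<close>, which is dominated by one
  plus the fourth power.\<close>

lemma gram_inner:
  fixes X :: "'a \<Rightarrow> real^'d"
  assumes M: "prob_space M" and X: "X \<in> borel_measurable M" and X4: "integrable M (\<lambda>\<omega>. norm (X \<omega>) ^ 4)"
  shows "integrable M (\<lambda>\<omega>. (norm (X \<omega>))\<^sup>2)"
    and "x \<bullet> (gram M X *v y) = (\<integral>\<omega>. (x \<bullet> X \<omega>) * (y \<bullet> X \<omega>) \<partial>M)"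
proof -
  interpret prob_space M by fact
  show X2: "integrable M (\<lambda>\<omega>. (norm (X \<omega>))\<^sup>2)"
  proof (rule Bochner_Integration.integrable_bound)
    show "integrable M (\<lambda>\<omega>. 1 + norm (X \<omega>) ^ 4)" using X4 by simp
    show "(\<lambda>\<omega>. (norm (X \<omega>))\<^sup>2) \<in> borel_measurable M" using X by measurable
    \<comment> \<open>Expanding the square of \<open>t\<^sup>2 - 1 / 2\<close> gives the sharper
      constant \<open>1 / 4\<close>.\<close>
    have le: "t\<^sup>2 \<le> 1 + t ^ 4" for t :: real
      using zero_le_power2[of "t\<^sup>2 - 1 / 2"] by (simp add: power2_diff power_mult[symmetric] power_divide)
    have "norm ((norm v)\<^sup>2) \<le> norm (1 + norm v ^ 4)" for v :: "real^'d"
      unfolding real_norm_def abs_power2 using le[of "norm v"] by linarith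
    then show "AE \<omega> in M. norm ((norm (X \<omega>))\<^sup>2) \<le> norm (1 + norm (X \<omega>) ^ 4)"
      by simp
  qed
  have meas: "(\<lambda>\<omega>. outer (X \<omega>)) \<in> borel_measurable M"
  proof -
    have "(\<lambda>\<omega>. outer (X \<omega>)) = (\<lambda>v. outer v) \<circ> X" by auto
    moreover have "continuous_on UNIV (outer :: real^'d \<Rightarrow> _)"
      unfolding outer_def by (intro continuous_intros)
    ultimately show ?thesis
      using X by (metis borel_measurable_continuous_onI measurable_comp)
  qed
  have int: "integrable M (\<lambda>\<omega>. outer (X \<omega>))"
  proof (rule Bochner_Integration.integrable_bound[OF X2 meas])
    have "norm (outer v) = (norm v)\<^sup>2" for v :: "real^'d"
    proof -
      have "outer v $ i = v $ i *\<^sub>R v" for i by (simp add: outer_def vec_eq_iff)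
      then have "norm (outer v) = L2_set (\<lambda>i. \<bar>v $ i\<bar> * norm v) UNIV"
        by (simp add: norm_vec_def[of "outer v"])
      also have "\<dots> = L2_set (\<lambda>i. norm (v $ i)) UNIV * norm v"
        by (simp add: L2_set_left_distrib)
      also have "\<dots> = (norm v)\<^sup>2"
        unfolding norm_vec_def[of v, symmetric] by (simp only: power2_eq_square)
      finally show ?thesis .
    qed
    then show "AE \<omega> in M. norm (outer (X \<omega>)) \<le> norm ((norm (X \<omega>))\<^sup>2)" by simp
  qed
  have "bounded_linear (\<lambda>A. x \<bullet> (A *v y))"
    by (intro linear_conv_bounded_linear[THEN iffD1] linearI)
      (simp_all add: matrix_vector_mult_add_rdistrib inner_add_right scaleR_matrix_vector_assoc[symmetric])
  from integral_bounded_linear[OF this int]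
  show "x \<bullet> (gram M X *v y) = (\<integral>\<omega>. (x \<bullet> X \<omega>) * (y \<bullet> X \<omega>) \<partial>M)"
    by (simp add: gram_def inner_outer_mult)
qed

text \<open>The form is the second moment of a projection, so it is nonnegative; Cauchy-Schwarz and
  the nonnegative variance of the squared norm bound it by \<open>s4_sq M X\<close>.\<close>

lemma gram_quad_form_bounds:
  fixes X :: "'a \<Rightarrow> real^'d"
  assumes M: "prob_space M" and X: "X \<in> borel_measurable M" and X4: "integrable M (\<lambda>\<omega>. norm (X \<omega>) ^ 4)"
  shows "0 \<le> quad_form (gram M X) x" and "norm x = 1 \<Longrightarrow> quad_form (gram M X) x \<le> s4_sq M X"
proof -
  interpret prob_space M by fact
  note g = gram_inner[OF assms]
  have quad: "quad_form (gram M X) x = (\<integral>\<omega>. (x \<bullet> X \<omega>)\<^sup>2 \<partial>M)"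
    by (simp add: quad_form_def g(2) power2_eq_square)
  show "0 \<le> quad_form (gram M X) x" unfolding quad by simp
  assume x: "norm x = 1"
  have le: "(x \<bullet> v)\<^sup>2 \<le> (norm v)\<^sup>2" for v
    using Cauchy_Schwarz_ineq2[of x v] x by (simp add: abs_le_square_iff[symmetric])
  have "quad_form (gram M X) x \<le> (\<integral>\<omega>. (norm (X \<omega>))\<^sup>2 \<partial>M)"
    unfolding quad
  proof (rule integral_mono[OF _ g(1)])
    show "integrable M (\<lambda>\<omega>. (x \<bullet> X \<omega>)\<^sup>2)"
      using X le by (intro Bochner_Integration.integrable_bound[OF g(1)]) auto
  qed (rule le)
  also have "\<dots> \<le> s4_sq M X"
    unfolding s4_sq_def
  proof (rule real_le_rsqrt)
    have "integrable M (\<lambda>\<omega>. ((norm (X \<omega>))\<^sup>2)\<^sup>2)" using X4 by (simp add: power_mult[symmetric])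
    from variance_eq[OF g(1) this] variance_positive[of "\<lambda>\<omega>. (norm (X \<omega>))\<^sup>2"]
    show "(\<integral>\<omega>. (norm (X \<omega>))\<^sup>2 \<partial>M)\<^sup>2 \<le> (\<integral>\<omega>. norm (X \<omega>) ^ 4 \<partial>M)"
      by (simp add: power_mult[symmetric])
  qed
  finally show "quad_form (gram M X) x \<le> s4_sq M X" .
qed

section \<open>From the deviation event to the error bound\<close>

theorem proposition5p3:
  fixes M :: "'a measure"
    and X :: "'a \<Rightarrow> real^'d"
    and Xs :: "nat \<Rightarrow> 'a \<Rightarrow> real^'d"
    and n :: nat
    and a \<delta> \<epsilon> \<sigma> :: real
    and Qfun :: "(nat \<Rightarrow> real^'d) \<Rightarrow> real^'d^'d"
    and Q Qplus Qminus Ghat Gtilde :: "'a \<Rightarrow> real^'d^'d"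
    and lam :: "nat \<Rightarrow> real"
    and lamhat :: "'a \<Rightarrow> nat \<Rightarrow> real"
    and q :: "'a \<Rightarrow> nat \<Rightarrow> real^'d"
  assumes "prob_space M"
    and "X \<in> borel_measurable M"
    and "integrable M (\<lambda>\<omega>. norm (X \<omega>) ^ 4)"
    and "n \<ge> 1"
    and "prob_space.indep_vars M (\<lambda>_. borel) Xs {1..n}"
    and "\<forall>i\<in>{1..n}. distr M borel (Xs i) = distr M borel X"
    and "a > 0" and "\<delta> > 0" and "0 < \<epsilon>" and "\<epsilon> < 1"
    \<comment> \<open>the estimators\<close>
    and "Qfun \<in> borel_measurable (Pi\<^sub>M {1..n} (\<lambda>_. borel))"
    and "\<forall>\<omega>\<in>space M. Q \<omega> = Qfun (\<lambda>i\<in>{1..n}. Xs i \<omega>)"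
    and "\<forall>\<omega>\<in>space M. transpose (Q \<omega>) = Q \<omega>"
    and "\<forall>\<omega>\<in>space M. pos_neg_parts (Q \<omega>) (Qplus \<omega>) (Qminus \<omega>)"
    and "\<forall>\<omega>\<in>space M. Ghat \<omega> = Qplus \<omega>"
    and "8 * zeta M X a \<epsilon> n \<sigma> \<le> sqrt (real n) \<and> \<sigma> \<le> s4_sq M X \<and> kurtosis M X \<ge> 3 / 2 \<longrightarrow>
      (\<exists>A\<in>sets M. measure M A \<ge> 1 - 2 * \<epsilon> \<and>
        (\<forall>\<omega>\<in>A. \<forall>\<theta>. norm \<theta> = 1 \<longrightarrow>
          ereal \<bar>max (quad_form (Q \<omega>) \<theta>) \<sigma> - max (quad_form (gram M X) \<theta>) \<sigma>\<bar>
            \<le> ereal (2 * max (quad_form (gram M X) \<theta>) \<sigma>)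
                * B_star M X a \<epsilon> n \<sigma> (quad_form (gram M X) \<theta>)
              + ereal (5 * \<delta> * frobenius (gram M X)) \<and>
          ereal \<bar>max (quad_form (Q \<omega>) \<theta>) \<sigma> - max (quad_form (gram M X) \<theta>) \<sigma>\<bar>
            \<le> ereal (2 * max (quad_form (Q \<omega>) \<theta>) \<sigma>)
                * B_star M X a \<epsilon> n \<sigma> (min (quad_form (Q \<omega>) \<theta>) (s4_sq M X))
              + ereal (5 * \<delta> * frobenius (gram M X)) \<and>
          ereal \<bar>max (quad_form (Ghat \<omega>) \<theta>) \<sigma> - max (quad_form (gram M X) \<theta>) \<sigma>\<bar>
            \<le> ereal (2 * max (quad_form (gram M X) \<theta>) \<sigma>)
                * B_star M X a \<epsilon> n \<sigma> (quad_form (gram M X) \<theta>)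
              + ereal (7 * \<delta> * frobenius (gram M X)) \<and>
          ereal \<bar>max (quad_form (Ghat \<omega>) \<theta>) \<sigma> - max (quad_form (gram M X) \<theta>) \<sigma>\<bar>
            \<le> ereal (2 * max (quad_form (Ghat \<omega>) \<theta>) \<sigma>)
                * B_star M X a \<epsilon> n \<sigma> (min (quad_form (Ghat \<omega>) \<theta>) (s4_sq M X))
              + ereal (7 * \<delta> * frobenius (gram M X))))"
    and "sorted_eigenvalues (gram M X) lam"
    and "\<forall>\<omega>\<in>space M. antimono_on {1..CARD('d)} (lamhat \<omega>) \<and>
           orthonormal_eigenbasis (Ghat \<omega>) (lamhat \<omega>) (q \<omega>)"
    and "\<forall>\<omega>\<in>space M. Gtilde \<omega> =
           modified_estimator (B_bound M X a \<epsilon> n \<sigma> \<delta>) (lamhat \<omega>) (q \<omega>)"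
    \<comment> \<open>the hypotheses of the proposition\<close>
    and "8 * zeta M X a \<epsilon> n \<sigma> \<le> sqrt (real n)"
    and "0 < \<sigma>" and "\<sigma> \<le> s4_sq M X"
    and "kurtosis M X \<ge> 3 / 2"
  shows "\<exists>A\<in>sets M. measure M A \<ge> 1 - 2 * \<epsilon> \<and>
    (\<forall>\<omega>\<in>A.
      ereal (frobenius (gram M X - Gtilde \<omega>))
        \<le> Min ((\<lambda>r. ereal_sqrt
                   (13 * ereal (real r) * (B_bound M X a \<epsilon> n \<sigma> \<delta> (lam 1))\<^sup>2
                    + ereal (2 * (\<Sum>i = r + 1..CARD('d). (lam i)\<^sup>2))))
               ` {1..CARD('d)}))"
proof -
  let ?D = "{1..CARD('d)}" and ?G = "gram M X" and ?S = "s4_sq M X"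
  obtain b where b: "\<And>t. B_bound M X a \<epsilon> n \<sigma> \<delta> t = ereal (b t)"
    and b_dev: "\<And>t. ereal (2 * max t \<sigma>) * B_star M X a \<epsilon> n \<sigma> (min t ?S)
        + ereal (7 * \<delta> * frobenius ?G) = ereal (b t - \<sigma>)"
    and b0: "\<And>t. 0 \<le> b t" and bmono: "\<And>s t. s \<le> t \<Longrightarrow> b s \<le> b t"
    and blip: "\<And>s t. s \<le> t \<Longrightarrow> b t - b s \<le> (t - s) / 2"
    using B_bound_finite[OF assms(9,10,23,21,22,8,4,20)] by blast
  obtain A where A: "A \<in> sets M" "1 - 2 * \<epsilon> \<le> measure M A"
    and A3: "\<And>\<omega> x. \<omega> \<in> A \<Longrightarrow> norm x = 1 \<Longrightarrow>
        ereal \<bar>max (quad_form (Ghat \<omega>) x) \<sigma> - max (quad_form ?G x) \<sigma>\<bar>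
          \<le> ereal (2 * max (quad_form ?G x) \<sigma>) * B_star M X a \<epsilon> n \<sigma> (quad_form ?G x)
            + ereal (7 * \<delta> * frobenius ?G)"
    and A4: "\<And>\<omega> x. \<omega> \<in> A \<Longrightarrow> norm x = 1 \<Longrightarrow>
        ereal \<bar>max (quad_form (Ghat \<omega>) x) \<sigma> - max (quad_form ?G x) \<sigma>\<bar>
          \<le> ereal (2 * max (quad_form (Ghat \<omega>) x) \<sigma>)
              * B_star M X a \<epsilon> n \<sigma> (min (quad_form (Ghat \<omega>) x) ?S)
            + ereal (7 * \<delta> * frobenius ?G)"
    using assms(16,20,22,23) by blast
  note gram = assms(1-3)
  have "x \<bullet> (?G *v y) = (?G *v x) \<bullet> y" for x y
    unfolding inner_commute[of "?G *v x"] gram_inner(2)[OF gram] by (simp add: mult.commute)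
  then obtain p where p: "orthonormal_eigenbasis ?G lam p"
    using sorted_eigenvalues_eigenbasis assms(17) by blast
  have lam: "antimono_on ?D lam" using assms(17) by (simp add: sorted_eigenvalues_def)
  have main: "ereal (frobenius (?G - Gtilde \<omega>)) \<le> ereal_sqrt
      (13 * ereal (real r) * (B_bound M X a \<epsilon> n \<sigma> \<delta> (lam 1))\<^sup>2
        + ereal (2 * (\<Sum>i = r + 1..CARD('d). (lam i)\<^sup>2)))"
    if \<omega>: "\<omega> \<in> A" and r: "r \<in> ?D" for \<omega> r
  proof -
    have sp: "\<omega> \<in> space M" using \<omega> sets.sets_into_space[OF A(1)] by blast
    have H: "orthonormal_eigenbasis (Ghat \<omega>) (lamhat \<omega>) (q \<omega>)" "antimono_on ?D (lamhat \<omega>)"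
      using assms(18) sp by auto
    \<comment> \<open>Positive semidefiniteness of \<open>Ghat\<close> is read off in an eigenbasis
      of \<open>Q\<close>, where the positive part has eigenvalues
      \<open>max (\<mu> i) 0\<close>.\<close>
    obtain \<mu> v where v: "orthonormal_eigenbasis (Q \<omega>) \<mu> v"
      and "Qplus \<omega> = spectral_sum (\<lambda>i. max (\<mu> i) 0) v"
      using assms(14) sp unfolding pos_neg_parts_def by blast
    then have "Ghat \<omega> = spectral_sum (\<lambda>i. max (\<mu> i) 0) v" using assms(15) sp by simp
    then have "orthonormal_eigenbasis (Ghat \<omega>) (\<lambda>i. max (\<mu> i) 0) v"
      using spectral_sum_eigenbasis[OF orthonormal_eigenbasis_basis[OF v]] by simp
    note H0 = eigenbasis_quad_form_ge[OF this, of _ 0, simplified]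
    have G0: "0 \<le> quad_form ?G x" for x by (rule gram_quad_form_bounds(1)[OF gram])
    have dev: "\<bar>quad_form (Ghat \<omega>) x - quad_form ?G x\<bar> \<le> b (quad_form ?G x)"
      "\<bar>quad_form (Ghat \<omega>) x - quad_form ?G x\<bar> \<le> b (quad_form (Ghat \<omega>) x)"
      if x: "norm x = 1" for x
    proof -
      \<comment> \<open>The form of \<open>?G\<close> stays below \<open>?S\<close>, so the bound in
        terms of \<open>?G\<close> also has the shape of \<open>b_dev\<close>.\<close>
      have "min (quad_form ?G x) ?S = quad_form ?G x"
        using gram_quad_form_bounds(2)[OF gram x] by simp
      then have "\<bar>max (quad_form (Ghat \<omega>) x) \<sigma> - max (quad_form ?G x) \<sigma>\<bar> \<le> b (quad_form ?G x) - \<sigma>"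
        using A3[OF \<omega> x] b_dev[of "quad_form ?G x"] by simp
      moreover have "\<bar>max (quad_form (Ghat \<omega>) x) \<sigma> - max (quad_form ?G x) \<sigma>\<bar>
          \<le> b (quad_form (Ghat \<omega>) x) - \<sigma>"
        using A4[OF \<omega> x] b_dev[of "quad_form (Ghat \<omega>) x"] by simp
      \<comment> \<open>Truncation raises a nonnegative number by between 0 and
        \<open>\<sigma>\<close>, so it changes the difference of two such numbers by at most
        \<open>\<sigma>\<close>.\<close>
      moreover have "\<bar>quad_form (Ghat \<omega>) x - quad_form ?G x\<bar>
          \<le> \<bar>max (quad_form (Ghat \<omega>) x) \<sigma> - max (quad_form ?G x) \<sigma>\<bar> + \<sigma>"
        using H0[OF x] G0[of x] \<open>0 < \<sigma>\<close> by (auto simp: max_def abs_if)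
      ultimately show "\<bar>quad_form (Ghat \<omega>) x - quad_form ?G x\<bar> \<le> b (quad_form ?G x)"
        "\<bar>quad_form (Ghat \<omega>) x - quad_form ?G x\<bar> \<le> b (quad_form (Ghat \<omega>) x)"
        by linarith+
    qed
    have "Gtilde \<omega> = spectral_sum (\<lambda>i. max (lamhat \<omega> i - b (lamhat \<omega> i)) 0) (q \<omega>)"
    proof -
      have "real_of_ereal (max (ereal s) 0) = max s 0" for s
        by (simp add: max_def)
      then show ?thesis using assms(19) sp by (simp add: modified_estimator_def b)
    qed
    then have "(frobenius (?G - Gtilde \<omega>))\<^sup>2
        \<le> 13 * real r * (b (lam 1))\<^sup>2 + 2 * (\<Sum>i = r + 1..CARD('d). (lam i)\<^sup>2)"
      using frobenius_shrunk_estimator_le[OF p lam H G0 H0 b0 bmono blip dev r] by simp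
    then have "frobenius (?G - Gtilde \<omega>)
        \<le> sqrt (13 * real r * (b (lam 1))\<^sup>2 + 2 * (\<Sum>i = r + 1..CARD('d). (lam i)\<^sup>2))"
      by (rule real_le_rsqrt)
    moreover have "13 * ereal (real r) * (B_bound M X a \<epsilon> n \<sigma> \<delta> (lam 1))\<^sup>2
        + ereal (2 * (\<Sum>i = r + 1..CARD('d). (lam i)\<^sup>2))
      = ereal (13 * real r * (b (lam 1))\<^sup>2 + 2 * (\<Sum>i = r + 1..CARD('d). (lam i)\<^sup>2))"
      unfolding b by (simp add: numeral_eq_ereal)
    ultimately show ?thesis by (simp add: ereal_sqrt_def)
  qed
  have "?D \<noteq> {}" by (simp add: One_nat_def)
  \<comment> \<open>The event is the same for all \<open>r\<close>, so the estimate passes to the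
    minimum over the finite nonempty range.\<close>
  with A main show ?thesis by (intro bexI[of _ A] conjI ballI) (auto intro!: Min.boundedI)
qed

end
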